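(* Let $(R,V)$ be a generalized root system and let $S'$ and $S''$ be two bases of $R$. There exist a sequence of bases of $R$ $$S' = S_0, S_1, \ldots, S_k = S''$$ and roots $\alpha_i \in S_i$ for $0 \le i \le k-1$ such that $S_{i+1} = \sigma_{\alpha_i}(S_i)$ for every $0\le i\le k-1$, where $\sigma_{\alpha}$ denotes the virtual reflection along $\alpha$.
   Context: A generalized root system (GRS) is a pair $(R,V)$ where $V$ is a finite-dimensional Euclidean space and $R\subset V$ is a non-empty finite set such that: (i) $V=\operatorname{span} R$; (ii) for all $\alpha,\beta\in R$: if $\langle\alpha,\beta\rangle<0$ then $\alpha+\beta\in R$; if $\langle\alpha,\beta\rangle>0$ then $\alpha-\beta\in R$; if $\langle\alpha,\beta\rangle=0$ then $\alpha+\beta\in R$ if and only if $\alpha-\beta\in R$. (It follows that $0\in R$ and $R=-R$.) Elements of $R$ are called roots. A base of $R$ is a subset $S\subset R$ which is a basis of $V$ and such that every $\beta\in R$ can be written $\beta=\sum_{\alpha\in S}m_\alpha\alpha$ with all $m_\alpha\in\mathbb{Z}_{\ge0}$ or all $m_\alpha\in\mathbb{Z}_{\le0}$. A nonzero root $\alpha$ is primitive if $\alpha=k\alpha'$ with $\alpha'\in R$, $k\in\mathbb{Z}_{>0}$ implies $k=1$. For $0\ne\alpha\in R$ and $\beta\in R$, the $\alpha$-string through $\beta$ is the set of roots of the form $\beta+k\alpha$, $k\in\mathbb{Z}$; the set of such $k$ is an interval of integers. Virtual reflection: for a primitive $\alpha\in R$, $\sigma_\alpha$ is the permutation of $R$ which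 reverses every $\alpha$-string, i.e. if $\beta,\beta+\alpha,\ldots,\beta+q\alpha$ is a (full) $\alpha$-string, then $\sigma_\alpha(\beta+i\alpha)=\beta+(q-i)\alpha$ for $0\le i\le q$. If $\alpha\neq 0$ is not primitive, $\sigma_\alpha:=\sigma_{\alpha'}$, where $\alpha=k\alpha'$ with $k\in\mathbb{Z}_{>0}$ and $\alpha'\in R$ primitive. *)

theory Defs
  imports "HOL-Analysis.Analysis"
begin

(* V is a subspace of an ambient real inner product space rather than a whole type, because
   the carrier of a type of class euclidean_space is never the zero space, whereas
   R = {0}, V = {0} is a generalized root system.  V is a finite-dimensional subspace
   by virtue of V = span R with R finite. *)
definition generalized_root_system :: "'a::real_inner set \<Rightarrow> 'a set \<Rightarrow> bool" where
  "generalized_root_system R V \<longleftrightarrow>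
     finite R \<and> R \<noteq> {} \<and> V = span R \<and>
     (\<forall>\<alpha>\<in>R. \<forall>\<beta>\<in>R.
        (\<alpha> \<bullet> \<beta> < 0 \<longrightarrow> \<alpha> + \<beta> \<in> R) \<and>
        (\<alpha> \<bullet> \<beta> > 0 \<longrightarrow> \<alpha> - \<beta> \<in> R) \<and>
        (\<alpha> \<bullet> \<beta> = 0 \<longrightarrow> (\<alpha> + \<beta> \<in> R \<longleftrightarrow> \<alpha> - \<beta> \<in> R)))"

definition is_base :: "'a::real_inner set \<Rightarrow> 'a set \<Rightarrow> 'a set \<Rightarrow> bool" where
  "is_base R V S \<longleftrightarrow>
     S \<subseteq> R \<and> independent S \<and> span S = V \<and>
     (\<forall>\<beta>\<in>R. \<exists>m :: 'a \<Rightarrow> int.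
        \<beta> = (\<Sum>\<alpha>\<in>S. of_int (m \<alpha>) *\<^sub>R \<alpha>) \<and>
        ((\<forall>\<alpha>\<in>S. m \<alpha> \<ge> 0) \<or> (\<forall>\<alpha>\<in>S. m \<alpha> \<le> 0)))"

definition primitive_root :: "'a::real_inner set \<Rightarrow> 'a \<Rightarrow> bool" where
  "primitive_root R \<alpha> \<longleftrightarrow>
     \<alpha> \<in> R \<and> \<alpha> \<noteq> 0 \<and>
     (\<forall>\<alpha>'\<in>R. \<forall>k::nat. k > 0 \<longrightarrow> \<alpha> = of_nat k *\<^sub>R \<alpha>' \<longrightarrow> k = 1)"

definition root_string :: "'a::real_inner set \<Rightarrow> 'a \<Rightarrow> 'a \<Rightarrow> 'a set" where
  "root_string R \<alpha> \<beta> = {\<gamma> \<in> R. \<exists>k::int. \<gamma> = \<beta> + of_int k *\<^sub>R \<alpha>}"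

(* Meaningful for primitive \<alpha>.  Roots are the only arguments of interest; elsewhere the
   reflection is the identity by convention. *)
definition primitive_reflection :: "'a::real_inner set \<Rightarrow> 'a \<Rightarrow> 'a \<Rightarrow> 'a" where
  "primitive_reflection R \<alpha> \<gamma> =
     (if \<gamma> \<in> R then
        (THE \<delta>. \<exists>\<beta> q i.
           root_string R \<alpha> \<beta> = (\<lambda>j. \<beta> + of_nat j *\<^sub>R \<alpha>) ` {0..q} \<and> i \<le> q \<and>
           \<gamma> = \<beta> + of_nat i *\<^sub>R \<alpha> \<and> \<delta> = \<beta> + of_nat (q - i) *\<^sub>R \<alpha>)
      else \<gamma>)"

definition virtual_reflection :: "'a::real_inner set \<Rightarrow> 'a \<Rightarrow> 'a \<Rightarrow> 'a" where
  "virtual_reflection R \<alpha> =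
     (if primitive_root R \<alpha> then primitive_reflection R \<alpha>
      else primitive_reflection R
             (THE \<alpha>'. primitive_root R \<alpha>' \<and> (\<exists>k::nat. k > 0 \<and> \<alpha> = of_nat k *\<^sub>R \<alpha>')))"

(* The facts below show that both definite descriptions above are well-defined. *)

lemma grs_add: "generalized_root_system R V \<Longrightarrow> \<alpha> \<in> R \<Longrightarrow> \<beta> \<in> R \<Longrightarrow> \<alpha> \<bullet> \<beta> < 0 \<Longrightarrow> \<alpha> + \<beta> \<in> R"
  and grs_diff: "generalized_root_system R V \<Longrightarrow> \<alpha> \<in> R \<Longrightarrow> \<beta> \<in> R \<Longrightarrow> \<alpha> \<bullet> \<beta> > 0 \<Longrightarrow> \<alpha> - \<beta> \<in> R"
  unfolding generalized_root_system_def by blast+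

lemma root_string_gap_free:
  fixes R :: "'a::real_inner set" and m :: nat
  assumes grs: "generalized_root_system R V" and \<alpha>: "\<alpha> \<in> R" "\<alpha> \<noteq> 0"
    and "\<beta> \<in> R" "\<beta> + of_nat m *\<^sub>R \<alpha> \<in> R"
  shows "i \<le> m \<Longrightarrow> \<beta> + of_nat i *\<^sub>R \<alpha> \<in> R"
  using assms(4,5)
proof (induction m arbitrary: \<beta> i)
  case 0
  then show ?case by simp
next
  case (Suc m)
  show ?case
  proof (cases "\<beta> \<bullet> \<alpha> < 0")
    case True
    then have \<beta>': "\<beta> + \<alpha> \<in> R" using grs_add[OF grs Suc.prems(2) \<alpha>(1)] by blast
    show ?thesis
    proof (cases i)
      case 0
      then show ?thesis using Suc.prems by simp
    next
      case (Suc j)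
      have "\<beta> + \<alpha> + of_nat j *\<^sub>R \<alpha> \<in> R"
        using Suc.IH[of j "\<beta> + \<alpha>"] Suc.prems \<beta>' Suc by (simp add: algebra_simps)
      then show ?thesis using Suc by (simp add: algebra_simps)
    qed
  next
    case False
    have "\<alpha> \<bullet> \<alpha> > 0" using \<alpha> by simp
    then have "(\<beta> + of_nat (Suc m) *\<^sub>R \<alpha>) \<bullet> \<alpha> > 0"
      using False by (simp add: inner_add_left add_nonneg_pos del: of_nat_Suc)
    then have "\<beta> + of_nat (Suc m) *\<^sub>R \<alpha> - \<alpha> \<in> R"
      using grs_diff[OF grs Suc.prems(3) \<alpha>(1)] by blast
    then have *: "\<beta> + of_nat m *\<^sub>R \<alpha> \<in> R" by (simp add: algebra_simps)
    show ?thesis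
    proof (cases "i = Suc m")
      case True
      then show ?thesis using Suc.prems by simp
    next
      case False
      then show ?thesis using Suc.IH[of i \<beta>] Suc.prems * by simp
    qed
  qed
qed

lemma root_string_exists:
  fixes R :: "'a::real_inner set"
  assumes grs: "generalized_root_system R V" and \<alpha>: "\<alpha> \<in> R" "\<alpha> \<noteq> 0" and \<gamma>: "\<gamma> \<in> R"
  shows "\<exists>\<beta> q i. root_string R \<alpha> \<beta> = (\<lambda>j. \<beta> + of_nat j *\<^sub>R \<alpha>) ` {0..q} \<and> i \<le> q \<and>
           \<gamma> = \<beta> + of_nat i *\<^sub>R \<alpha>"
proof -
  define K where "K = {k::int. \<gamma> + of_int k *\<^sub>R \<alpha> \<in> R}"
  have "finite R" using grs by (simp add: generalized_root_system_def)
  moreover have "inj (\<lambda>k::int. \<gamma> + of_int k *\<^sub>R \<alpha>)" using \<alpha> by (auto simp: inj_def)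
  ultimately have fin: "finite K"
    unfolding K_def using finite_vimageI[of R "\<lambda>k::int. \<gamma> + of_int k *\<^sub>R \<alpha>"] by (simp add: vimage_def)
  have "0 \<in> K" using \<gamma> by (simp add: K_def)
  define a b where "a = Min K" and "b = Max K"
  have ab: "a \<in> K" "b \<in> K" "a \<le> 0" "0 \<le> b" "\<And>k. k \<in> K \<Longrightarrow> a \<le> k \<and> k \<le> b"
    using fin \<open>0 \<in> K\<close> by (auto simp: a_def b_def intro: Min_in Max_in)
  define \<beta> where "\<beta> = \<gamma> + of_int a *\<^sub>R \<alpha>"
  have \<beta>: "\<beta> \<in> R" using ab(1) by (simp add: K_def \<beta>_def)
  have shift: "\<beta> + of_int k *\<^sub>R \<alpha> = \<gamma> + of_int (a + k) *\<^sub>R \<alpha>" for k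
    by (simp add: \<beta>_def algebra_simps)
  have top: "\<beta> + of_nat (nat (b - a)) *\<^sub>R \<alpha> \<in> R"
    using ab shift[of "b - a"] by (simp add: K_def)
  have "root_string R \<alpha> \<beta> = (\<lambda>j. \<beta> + of_nat j *\<^sub>R \<alpha>) ` {0..nat (b - a)}"
  proof (intro equalityI subsetI)
    fix \<delta> assume "\<delta> \<in> root_string R \<alpha> \<beta>"
    then obtain k :: int where k: "\<delta> \<in> R" "\<delta> = \<beta> + of_int k *\<^sub>R \<alpha>"
      by (auto simp: root_string_def)
    then have "a + k \<in> K" using shift[of k] by (simp add: K_def)
    then have "0 \<le> k" "k \<le> b - a" using ab(5) by force+
    then show "\<delta> \<in> (\<lambda>j. \<beta> + of_nat j *\<^sub>R \<alpha>) ` {0..nat (b - a)}"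
      using k by (intro image_eqI[of _ _ "nat k"]) auto
  next
    fix \<delta> assume "\<delta> \<in> (\<lambda>j. \<beta> + of_nat j *\<^sub>R \<alpha>) ` {0..nat (b - a)}"
    then obtain j where "j \<le> nat (b - a)" "\<delta> = \<beta> + of_nat j *\<^sub>R \<alpha>" by auto
    then show "\<delta> \<in> root_string R \<alpha> \<beta>"
      using root_string_gap_free[OF grs \<alpha> \<beta> top]
      by (auto simp: root_string_def intro!: exI[of _ "int j"])
  qed
  moreover have "nat (- a) \<le> nat (b - a)" "\<gamma> = \<beta> + of_nat (nat (- a)) *\<^sub>R \<alpha>"
    using ab by (auto simp: \<beta>_def)
  ultimately show ?thesis by blast
qed

lemma primitive_reflection_string:
  fixes R :: "'a::real_inner set"
  assumes "\<alpha> \<noteq> 0"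
    and str: "root_string R \<alpha> \<beta> = (\<lambda>j. \<beta> + of_nat j *\<^sub>R \<alpha>) ` {0..q}" and "i \<le> q"
  shows "primitive_reflection R \<alpha> (\<beta> + of_nat i *\<^sub>R \<alpha>) = \<beta> + of_nat (q - i) *\<^sub>R \<alpha>"
proof -
  let ?P = "\<lambda>\<delta>. \<exists>\<beta>' q' i'.
           root_string R \<alpha> \<beta>' = (\<lambda>j. \<beta>' + of_nat j *\<^sub>R \<alpha>) ` {0..q'} \<and> i' \<le> q' \<and>
           \<beta> + of_nat i *\<^sub>R \<alpha> = \<beta>' + of_nat i' *\<^sub>R \<alpha> \<and> \<delta> = \<beta>' + of_nat (q' - i') *\<^sub>R \<alpha>"
  have char: "\<beta>0 + of_int k *\<^sub>R \<alpha> \<in> R \<longleftrightarrow> 0 \<le> k \<and> k \<le> int q0"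
    if "root_string R \<alpha> \<beta>0 = (\<lambda>j. \<beta>0 + of_nat j *\<^sub>R \<alpha>) ` {0..q0}" for \<beta>0 q0 and k :: int
  proof -
    have "\<beta>0 + of_int k *\<^sub>R \<alpha> \<in> R \<longleftrightarrow> \<beta>0 + of_int k *\<^sub>R \<alpha> \<in> root_string R \<alpha> \<beta>0"
      by (auto simp: root_string_def)
    also have "\<dots> \<longleftrightarrow> (\<exists>j\<in>{0..q0}. of_int k = (of_nat j :: real))"
      unfolding that using \<open>\<alpha> \<noteq> 0\<close> by auto
    also have "\<dots> \<longleftrightarrow> (\<exists>j\<in>{0..q0}. k = int j)"
      by (metis of_int_eq_iff of_int_of_nat_eq)
    also have "\<dots> \<longleftrightarrow> 0 \<le> k \<and> k \<le> int q0" 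
      by (metis atLeastAtMost_iff nonneg_int_cases of_nat_0_le_iff of_nat_le_iff zero_le)
    finally show ?thesis .
  qed
  have "\<delta> = \<beta> + of_nat (q - i) *\<^sub>R \<alpha>" if P: "?P \<delta>" for \<delta>
  proof -
    obtain \<beta>' q' i' where
      str': "root_string R \<alpha> \<beta>' = (\<lambda>j. \<beta>' + of_nat j *\<^sub>R \<alpha>) ` {0..q'}" and i': "i' \<le> q'"
      and eq: "\<beta> + of_nat i *\<^sub>R \<alpha> = \<beta>' + of_nat i' *\<^sub>R \<alpha>" and \<delta>: "\<delta> = \<beta>' + of_nat (q' - i') *\<^sub>R \<alpha>"
      using P by blast
    have \<beta>': "\<beta>' = \<beta> + (of_nat i - of_nat i') *\<^sub>R \<alpha>"
      using eq by (simp add: algebra_simps)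
    have sh: "\<beta>' + of_int k *\<^sub>R \<alpha> = \<beta> + of_int (k + int i - int i') *\<^sub>R \<alpha>" for k
      by (simp add: \<beta>' algebra_simps)
    have *: "(0 \<le> k \<and> k \<le> int q') \<longleftrightarrow> (0 \<le> k + int i - int i' \<and> k + int i - int i' \<le> int q)" for k
      using char[OF str', of k] char[OF str, of "k + int i - int i'"] sh[of k] by simp
    have "i = i'" "q = q'"
      using *[of 0] *[of "int i' - int i"] *[of "int q'"] *[of "int q + int i' - int i"] by auto
    then show ?thesis using \<delta> \<beta>' by simp
  qed
  moreover have "?P (\<beta> + of_nat (q - i) *\<^sub>R \<alpha>)"
    using str \<open>i \<le> q\<close> by blast
  ultimately have "(THE \<delta>. ?P \<delta>) = \<beta> + of_nat (q - i) *\<^sub>R \<alpha>"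
    by (rule the_equality[rotated])
  moreover have "\<beta> + of_nat i *\<^sub>R \<alpha> \<in> R"
    using char[OF str, of "int i"] \<open>i \<le> q\<close> by simp
  ultimately show ?thesis
    unfolding primitive_reflection_def by simp
qed

lemma primitive_root_multiple_unique:
  fixes R :: "'a::real_inner set"
  assumes grs: "generalized_root_system R V" and "\<alpha> \<in> R" "\<alpha> \<noteq> 0"
  shows "\<exists>!\<alpha>'. primitive_root R \<alpha>' \<and> (\<exists>k::nat. k > 0 \<and> \<alpha> = of_nat k *\<^sub>R \<alpha>')"
proof (rule ex_ex1I)
  define D where "D = {\<delta> \<in> R. \<exists>k::nat. k > 0 \<and> \<alpha> = of_nat k *\<^sub>R \<delta>}"
  have "finite D" "\<alpha> \<in> D"
    using grs assms by (auto simp: D_def generalized_root_system_def intro!: exI[of _ "1::nat"])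
  then obtain \<delta> where \<delta>: "\<delta> \<in> D" "\<And>\<delta>'. \<delta>' \<in> D \<Longrightarrow> norm \<delta> \<le> norm \<delta>'"
    using ex_min_if_finite[of "norm ` D"] by (metis arg_min_if_finite(1) arg_min_least empty_iff)
  obtain k :: nat where k: "k > 0" "\<alpha> = of_nat k *\<^sub>R \<delta>" using \<delta> by (auto simp: D_def)
  have "\<delta> \<noteq> 0" using k \<open>\<alpha> \<noteq> 0\<close> by auto
  have "l = 1" if "\<delta>' \<in> R" "l > 0" "\<delta> = of_nat l *\<^sub>R \<delta>'" for \<delta>' and l :: nat
  proof -
    have "\<delta>' \<in> D" using that k by (auto simp: D_def intro!: exI[of _ "k * l"])
    then have "norm \<delta> \<le> norm \<delta>'" by (rule \<delta>(2))
    moreover have "norm \<delta>' > 0" using that \<open>\<delta> \<noteq> 0\<close> by auto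
    ultimately have "real l \<le> 1" using that by simp
    then show ?thesis using \<open>l > 0\<close> by simp
  qed
  then have "primitive_root R \<delta>"
    using \<delta>(1) \<open>\<delta> \<noteq> 0\<close> by (auto simp: primitive_root_def D_def)
  then show "\<exists>\<alpha>'. primitive_root R \<alpha>' \<and> (\<exists>k::nat. k > 0 \<and> \<alpha> = of_nat k *\<^sub>R \<alpha>')"
    using k by blast
next
  (* Euclidean algorithm along a ray of roots *)
  have gcd: "of_nat (gcd m n) *\<^sub>R \<epsilon> \<in> R"
    if "\<epsilon> \<noteq> 0" "m > 0" "n > 0" "of_nat m *\<^sub>R \<epsilon> \<in> R" "of_nat n *\<^sub>R \<epsilon> \<in> R" for \<epsilon> :: 'a and m n :: nat
    using that(2-)
  proof (induction "m + n" arbitrary: m n rule: less_induct)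
    case less
    have pos: "(of_nat a *\<^sub>R \<epsilon>) \<bullet> (of_nat b *\<^sub>R \<epsilon>) > 0" if "a > 0" "b > 0" for a b :: nat
      using that \<open>\<epsilon> \<noteq> 0\<close> by simp
    consider "m = n" | "m < n" | "n < m" by linarith
    then show ?case
    proof cases
      case 1
      then show ?thesis using less.prems by simp
    next
      case 2
      then have "of_nat (n - m) *\<^sub>R \<epsilon> \<in> R"
        using grs_diff[OF grs less.prems(4,3) pos] less.prems
        by (simp add: of_nat_diff scaleR_diff_left)
      then have "of_nat (gcd m (n - m)) *\<^sub>R \<epsilon> \<in> R"
        using less.hyps[of m "n - m"] less.prems 2 by simp
      then show ?thesis using 2 by (simp add: gcd.commute[of m] gcd_diff1_nat)
    next
      case 3
      then have "of_nat (m - n) *\<^sub>R \<epsilon> \<in> R"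
        using grs_diff[OF grs less.prems(3,4) pos] less.prems
        by (simp add: of_nat_diff scaleR_diff_left)
      then have "of_nat (gcd (m - n) n) *\<^sub>R \<epsilon> \<in> R"
        using less.hyps[of "m - n" n] less.prems 3 by simp
      then show ?thesis using 3 by (simp add: gcd_diff1_nat)
    qed
  qed
  fix \<beta> \<gamma>
  assume "primitive_root R \<beta> \<and> (\<exists>k::nat. k > 0 \<and> \<alpha> = of_nat k *\<^sub>R \<beta>)"
    and "primitive_root R \<gamma> \<and> (\<exists>k::nat. k > 0 \<and> \<alpha> = of_nat k *\<^sub>R \<gamma>)"
  then obtain k l :: nat where prim: "primitive_root R \<beta>" "primitive_root R \<gamma>"
    and kl: "k > 0" "l > 0" "\<alpha> = of_nat k *\<^sub>R \<beta>" "\<alpha> = of_nat l *\<^sub>R \<gamma>" by blast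
  define \<epsilon> where "\<epsilon> = (1 / (of_nat k * of_nat l)) *\<^sub>R \<alpha>"
  have "\<epsilon> = (1 / (of_nat k * of_nat l)) *\<^sub>R of_nat l *\<^sub>R \<gamma>" by (simp add: \<epsilon>_def kl(4)[symmetric])
  then have \<epsilon>: "\<epsilon> \<noteq> 0" "\<gamma> = of_nat k *\<^sub>R \<epsilon>" using kl(1,2) \<open>\<alpha> \<noteq> 0\<close> by (auto simp: \<epsilon>_def)
  have "\<epsilon> = (1 / (of_nat k * of_nat l)) *\<^sub>R of_nat k *\<^sub>R \<beta>" by (simp add: \<epsilon>_def kl(3)[symmetric])
  then have \<beta>: "\<beta> = of_nat l *\<^sub>R \<epsilon>" using kl(1,2) by simp
  have "of_nat (gcd k l) *\<^sub>R \<epsilon> \<in> R"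
    using gcd[of \<epsilon> k l] \<epsilon> \<beta> kl prim by (auto simp: primitive_root_def)
  moreover obtain a b where ab: "k = gcd k l * a" "l = gcd k l * b" by (meson dvdE gcd_dvd1 gcd_dvd2)
  moreover have "\<gamma> = of_nat a *\<^sub>R (of_nat (gcd k l) *\<^sub>R \<epsilon>)"
    using \<epsilon>(2) arg_cong[OF ab(1), of real] by (simp add: mult.commute)
  moreover have "\<beta> = of_nat b *\<^sub>R (of_nat (gcd k l) *\<^sub>R \<epsilon>)"
    using \<beta> arg_cong[OF ab(2), of real] by (simp add: mult.commute)
  moreover have "a > 0" "b > 0" using ab kl by (metis gr0I mult_0_right less_irrefl)+
  ultimately have "a = 1" "b = 1" using prim unfolding primitive_root_def by blast+
  then show "\<beta> = \<gamma>" using ab \<beta> \<epsilon>(2) by simp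
qed

end

theory Submission
  imports Defs
begin

text \<open>
  A linear functional \<open>f\<close> that vanishes at no nonzero root divides the nonzero roots into positive
  and negative ones. The indecomposable positive roots then form a base, by the classical argument:
  two of them enclose an angle of at least 90 degrees, since otherwise their difference would be a
  root and would decompose one of the two; and vectors in an open half-space with pairwise obtuse
  angles are linearly independent (\<open>simple_roots_is_base\<close>). Conversely, a base is the set of
  indecomposables of any functional that is positive on it (\<open>base_eq_simple_roots\<close>).

  Virtual reflections are recognised through this dictionary. Given a base \<open>S\<close> and \<open>\<alpha> \<in> S\<close>, move the
  functional across the wall of \<open>\<alpha>\<close>, so that the multiples of \<open>\<alpha>\<close> change sign and no other root does.
  The reflection sends \<open>\<alpha>\<close> to \<open>-\<alpha>\<close> and every other \<open>\<beta> \<in> S\<close> to the far end of its \<open>\<alpha>\<close>-string,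
  because \<open>\<beta>\<close> is the near end. These vectors are indecomposable for the new functional and span
  \<open>V\<close>, so they are all the indecomposables (\<open>reflected_base_eq_simple_roots\<close>). In particular the
  reflected set is a base again.

  To connect two bases, fix a functional positive on the target base. Unless the current base is
  already the target, one of its elements is negative for that functional. Reflecting along
  this element strictly shrinks the set of roots that are positive for the current
  base and negative for the target, so the process ends at the target.
\<close>

section \<open>Natural combinations of a base\<close>

definition nat_combinations :: "'a::real_vector set \<Rightarrow> 'a set" where
  "nat_combinations S = {\<Sum>\<alpha>\<in>S. of_nat (m \<alpha>) *\<^sub>R \<alpha> | m :: 'a \<Rightarrow> nat. True}"

lemma nat_combinationsI: "(\<Sum>\<alpha>\<in>S. of_nat (m \<alpha>) *\<^sub>R \<alpha>) \<in> nat_combinations S"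
  unfolding nat_combinations_def by blast

lemma nat_combinations_add:
  assumes "x \<in> nat_combinations S" "y \<in> nat_combinations S"
  shows "x + y \<in> nat_combinations S"
proof -
  obtain m n :: "'a \<Rightarrow> nat"
    where "x = (\<Sum>\<alpha>\<in>S. of_nat (m \<alpha>) *\<^sub>R \<alpha>)" "y = (\<Sum>\<alpha>\<in>S. of_nat (n \<alpha>) *\<^sub>R \<alpha>)"
    using assms unfolding nat_combinations_def by blast
  then have "x + y = (\<Sum>\<alpha>\<in>S. of_nat (m \<alpha> + n \<alpha>) *\<^sub>R \<alpha>)"
    by (simp add: scaleR_add_left sum.distrib)
  then show ?thesis by (simp only: nat_combinationsI)
qed

lemma nat_combinations_base:
  assumes "finite S" "\<alpha> \<in> S"
  shows "\<alpha> \<in> nat_combinations S"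
proof -
  have "(\<Sum>\<beta>\<in>S. of_nat (if \<beta> = \<alpha> then 1 else 0) *\<^sub>R \<beta>) = (\<Sum>\<beta>\<in>S. if \<beta> = \<alpha> then \<beta> else 0)"
    by (intro sum.cong) auto
  also have "\<dots> = \<alpha>" using assms by simp
  finally show ?thesis using nat_combinationsI[of "\<lambda>\<beta>. if \<beta> = \<alpha> then 1 else 0" S] by simp
qed

lemma nat_combinations_span: "x \<in> nat_combinations S \<Longrightarrow> x \<in> span S"
  unfolding nat_combinations_def by (auto intro!: span_sum intro: span_scale span_base)

lemma linear_nat_combination:
  fixes f :: "'a::real_vector \<Rightarrow> real"
  assumes "linear f"
  shows "f (\<Sum>\<alpha>\<in>S. of_nat (m \<alpha>) *\<^sub>R \<alpha>) = (\<Sum>\<alpha>\<in>S. of_nat (m \<alpha>) * f \<alpha>)"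
  by (simp add: linear_sum[OF assms] linear_scale[OF assms])

lemma nat_combinations_nonneg:
  fixes f :: "'a::real_vector \<Rightarrow> real"
  assumes "linear f" "\<forall>\<alpha>\<in>S. f \<alpha> \<ge> 0" "x \<in> nat_combinations S"
  shows "f x \<ge> 0"
  using assms by (auto simp: nat_combinations_def linear_nat_combination intro!: sum_nonneg)

lemma nat_combinations_eq_0:
  fixes f :: "'a::real_vector \<Rightarrow> real"
  assumes "finite S" "linear f" "\<forall>\<alpha>\<in>S. f \<alpha> > 0" "x \<in> nat_combinations S" "f x = 0"
  shows "x = 0"
proof -
  obtain m :: "'a \<Rightarrow> nat" where m: "x = (\<Sum>\<alpha>\<in>S. of_nat (m \<alpha>) *\<^sub>R \<alpha>)"
    using assms(4) unfolding nat_combinations_def by blast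
  have "(\<Sum>\<alpha>\<in>S. of_nat (m \<alpha>) * f \<alpha>) = 0"
    using assms(5) linear_nat_combination[OF assms(2), of m S] m by simp
  then have "\<forall>\<alpha>\<in>S. of_nat (m \<alpha>) * f \<alpha> = 0"
    using assms(1,3) by (subst (asm) sum_nonneg_eq_0_iff) (auto simp: less_imp_le)
  then show ?thesis using m assms(3) by (force intro!: sum.neutral)
qed

lemma nat_combinations_pos:
  fixes f :: "'a::real_vector \<Rightarrow> real"
  assumes "finite S" "linear f" "\<forall>\<alpha>\<in>S. f \<alpha> > 0" "x \<in> nat_combinations S" "x \<noteq> 0"
  shows "f x > 0"
  using nat_combinations_nonneg[of f S x] nat_combinations_eq_0[of S f x] assms
  by (auto simp: less_eq_real_def)

lemma nat_combinations_Ints: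
  fixes f :: "'a::real_vector \<Rightarrow> real"
  assumes "linear f" "\<forall>\<alpha>\<in>S. f \<alpha> \<in> \<int>" "x \<in> nat_combinations S"
  shows "f x \<in> \<int>"
  using assms by (auto simp: nat_combinations_def linear_nat_combination intro!: Ints_sum Ints_mult)

lemma base_finite: "generalized_root_system R V \<Longrightarrow> is_base R V S \<Longrightarrow> finite S"
  unfolding generalized_root_system_def is_base_def by (meson finite_subset)

lemma base_nonzero: "is_base R V S \<Longrightarrow> \<alpha> \<in> S \<Longrightarrow> \<alpha> \<noteq> 0"
  unfolding is_base_def using dependent_zero by blast

lemma base_root_cases:
  assumes "is_base R V S" "\<gamma> \<in> R"
  obtains "\<gamma> \<in> nat_combinations S" | "- \<gamma> \<in> nat_combinations S"
proof -
  obtain m :: "'a \<Rightarrow> int" where m: "\<gamma> = (\<Sum>\<alpha>\<in>S. of_int (m \<alpha>) *\<^sub>R \<alpha>)"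
    and sgn: "(\<forall>\<alpha>\<in>S. m \<alpha> \<ge> 0) \<or> (\<forall>\<alpha>\<in>S. m \<alpha> \<le> 0)"
    using assms unfolding is_base_def by blast
  from sgn show thesis
  proof
    assume "\<forall>\<alpha>\<in>S. m \<alpha> \<ge> 0"
    then have "\<gamma> = (\<Sum>\<alpha>\<in>S. of_nat (nat (m \<alpha>)) *\<^sub>R \<alpha>)" unfolding m by (intro sum.cong) auto
    then show thesis using that(1) nat_combinationsI[of "\<lambda>\<alpha>. nat (m \<alpha>)" S] by metis
  next
    assume "\<forall>\<alpha>\<in>S. m \<alpha> \<le> 0"
    then have "- \<gamma> = (\<Sum>\<alpha>\<in>S. of_nat (nat (- m \<alpha>)) *\<^sub>R \<alpha>)"
      unfolding m sum_negf[symmetric] by (intro sum.cong) auto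
    then show thesis using that(2) nat_combinationsI[of "\<lambda>\<alpha>. nat (- m \<alpha>)" S] by metis
  qed
qed

lemma is_baseI:
  assumes "S \<subseteq> R" "independent S" "span S = V"
    and "\<And>\<gamma>. \<gamma> \<in> R \<Longrightarrow> \<gamma> \<in> nat_combinations S \<or> - \<gamma> \<in> nat_combinations S"
  shows "is_base R V S"
  unfolding is_base_def
proof (intro conjI ballI)
  fix \<gamma> assume "\<gamma> \<in> R"
  then consider "\<gamma> \<in> nat_combinations S" | "- \<gamma> \<in> nat_combinations S" using assms(4) by blast
  then show "\<exists>m :: 'a \<Rightarrow> int. \<gamma> = (\<Sum>\<alpha>\<in>S. of_int (m \<alpha>) *\<^sub>R \<alpha>) \<and>
      ((\<forall>\<alpha>\<in>S. m \<alpha> \<ge> 0) \<or> (\<forall>\<alpha>\<in>S. m \<alpha> \<le> 0))"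
  proof cases
    case 1
    then obtain m :: "'a \<Rightarrow> nat" where "\<gamma> = (\<Sum>\<alpha>\<in>S. of_nat (m \<alpha>) *\<^sub>R \<alpha>)"
      unfolding nat_combinations_def by blast
    then show ?thesis by (intro exI[of _ "\<lambda>\<alpha>. int (m \<alpha>)"]) auto
  next
    case 2
    then obtain m :: "'a \<Rightarrow> nat" where "- \<gamma> = (\<Sum>\<alpha>\<in>S. of_nat (m \<alpha>) *\<^sub>R \<alpha>)"
      unfolding nat_combinations_def by blast
    then have "\<gamma> = - (\<Sum>\<alpha>\<in>S. of_nat (m \<alpha>) *\<^sub>R \<alpha>)" by (metis minus_minus)
    then show ?thesis by (intro exI[of _ "\<lambda>\<alpha>. - int (m \<alpha>)"]) (auto simp: sum_negf)
  qed
qed (use assms in auto)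

section \<open>Indecomposable positive roots\<close>

lemma grs_zero:
  assumes "generalized_root_system R V"
  shows "0 \<in> R"
proof -
  obtain \<alpha> where "\<alpha> \<in> R" using assms unfolding generalized_root_system_def by blast
  then show ?thesis using grs_diff[OF assms, of \<alpha> \<alpha>] by (cases "\<alpha> = 0") auto
qed

lemma grs_uminus:
  assumes "generalized_root_system R V" "\<alpha> \<in> R"
  shows "- \<alpha> \<in> R"
  \<comment> \<open>The third closure condition, for the orthogonal pair \<open>0, \<alpha>\<close>.\<close>
  using assms grs_zero[OF assms(1)] unfolding generalized_root_system_def
  by (metis add_0 diff_0 inner_zero_left)

definition generic_functional :: "'a::real_inner set \<Rightarrow> ('a \<Rightarrow> real) \<Rightarrow> bool" where
  "generic_functional R f \<longleftrightarrow> linear f \<and> (\<forall>\<gamma>\<in>R. \<gamma> \<noteq> 0 \<longrightarrow> f \<gamma> \<noteq> 0)"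

definition simple_roots :: "'a::real_inner set \<Rightarrow> ('a \<Rightarrow> real) \<Rightarrow> 'a set" where
  "simple_roots R f =
     {\<gamma> \<in> R. f \<gamma> > 0 \<and> \<not> (\<exists>\<delta>\<in>R. \<exists>\<epsilon>\<in>R. f \<delta> > 0 \<and> f \<epsilon> > 0 \<and> \<gamma> = \<delta> + \<epsilon>)}"

text \<open>
  In a vanishing linear combination, move the terms with negative coefficients to the other
  side. Both sides are then the same vector \<open>x\<close>, and obtuseness gives \<open>x \<bullet> x \<le> 0\<close>; so \<open>x = 0\<close>, and
  \<open>f\<close> forces each side to be an empty combination.
\<close>

lemma independent_if_obtuse:
  fixes A :: "'a::real_inner set" and f :: "'a \<Rightarrow> real"
  assumes fin: "finite A" and lin: "linear f" and pos: "\<And>x. x \<in> A \<Longrightarrow> f x > 0"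
    and obtuse: "\<And>x y. x \<in> A \<Longrightarrow> y \<in> A \<Longrightarrow> x \<noteq> y \<Longrightarrow> x \<bullet> y \<le> 0"
  shows "independent A"
proof
  assume "dependent A"
  then obtain u v where v: "v \<in> A" "u v \<noteq> 0" and u: "(\<Sum>x\<in>A. u x *\<^sub>R x) = 0"
    using dependent_finite[OF fin] by blast
  define p n where "p = (\<lambda>x. max 0 (u x))" and "n = (\<lambda>x. max 0 (- u x))"
  have nonneg: "p x \<ge> 0" "n x \<ge> 0" and dis: "p x = 0 \<or> n x = 0" and diff: "u x = p x - n x" for x
    by (auto simp: p_def n_def)
  define x where "x = (\<Sum>y\<in>A. p y *\<^sub>R y)"
  have xn: "x = (\<Sum>y\<in>A. n y *\<^sub>R y)"
    using u unfolding x_def diff by (simp add: scaleR_diff_left sum_subtractf)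
  have "x \<bullet> x = (\<Sum>y\<in>A. \<Sum>z\<in>A. p y * n z * (y \<bullet> z))"
    by (subst xn, subst x_def) (simp add: inner_sum_left inner_sum_right mult_ac inner_commute)
  also have "\<dots> \<le> 0"
  proof (intro sum_nonpos)
    fix y z assume "y \<in> A" "z \<in> A"
    then show "p y * n z * (y \<bullet> z) \<le> 0"
      using dis[of y] obtuse[of y z] nonneg by (cases "y = z") (auto intro: mult_nonneg_nonpos)
  qed
  finally have "x = 0" using inner_gt_zero_iff[of x] by linarith
  have zero: "w v = 0" if w: "\<And>y. w y \<ge> 0" "x = (\<Sum>y\<in>A. w y *\<^sub>R y)" for w :: "'a \<Rightarrow> real"
  proof -
    have "(\<Sum>y\<in>A. w y * f y) = 0"
      using \<open>x = 0\<close> linear_0[OF lin] arg_cong[OF w(2), of f]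
      by (simp add: linear_sum[OF lin] linear_scale[OF lin])
    then have "\<forall>y\<in>A. w y * f y = 0"
      using w pos fin by (subst (asm) sum_nonneg_eq_0_iff) (auto simp: less_imp_le)
    then show ?thesis using v pos by fastforce
  qed
  show False using zero[of p] zero[of n] nonneg x_def xn diff[of v] v by auto
qed

lemma simple_roots_obtuse:
  assumes grs: "generalized_root_system R V" and gen: "generic_functional R f"
    and x: "x \<in> simple_roots R f" and y: "y \<in> simple_roots R f" and "x \<noteq> y"
  shows "x \<bullet> y \<le> 0"
proof (rule ccontr)
  assume "\<not> x \<bullet> y \<le> 0"
  then have d: "x - y \<in> R" using grs_diff[OF grs] x y by (auto simp: simple_roots_def)
  then have d': "y - x \<in> R" using grs_uminus[OF grs d] by simp
  have "f (x - y) \<noteq> 0" using gen d \<open>x \<noteq> y\<close> unfolding generic_functional_def by auto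
  moreover have "f (y - x) = - f (x - y)"
    using gen unfolding generic_functional_def by (simp add: linear_diff)
  ultimately consider "f (x - y) > 0" | "f (y - x) > 0" by linarith
  then show False
  proof cases
    case 1
    then have "x = y + (x - y)" "f (x - y) > 0" by auto
    then show False using x y d unfolding simple_roots_def by blast
  next
    case 2
    then have "y = x + (y - x)" "f (y - x) > 0" by auto
    then show False using x y d' unfolding simple_roots_def by blast
  qed
qed

text \<open>
  Decomposing a positive root repeatedly ends in indecomposable ones, because the summands have
  smaller values of \<open>f\<close> and there are only finitely many roots.
\<close>

lemma positive_root_nat_combination:
  assumes fin: "finite R" and gen: "generic_functional R f"
    and "\<gamma> \<in> R" "f \<gamma> > 0"
  shows "\<gamma> \<in> nat_combinations (simple_roots R f)"
  using assms(3,4)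
proof (induction "card {\<delta> \<in> R. f \<delta> < f \<gamma>}" arbitrary: \<gamma> rule: less_induct)
  case less
  have finS: "finite (simple_roots R f)" using fin by (simp add: simple_roots_def)
  show ?case
  proof (cases "\<gamma> \<in> simple_roots R f")
    case True
    then show ?thesis by (rule nat_combinations_base[OF finS])
  next
    case False
    then obtain \<delta> \<epsilon> where *: "\<delta> \<in> R" "\<epsilon> \<in> R" "f \<delta> > 0" "f \<epsilon> > 0" "\<gamma> = \<delta> + \<epsilon>"
      using less.prems unfolding simple_roots_def by blast
    then have f: "f \<gamma> = f \<delta> + f \<epsilon>"
      using gen unfolding generic_functional_def by (simp add: linear_add)
    have "\<zeta> \<in> nat_combinations (simple_roots R f)" if \<zeta>: "\<zeta> \<in> R" "f \<zeta> > 0" "f \<zeta> < f \<gamma>" for \<zeta>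
    proof (rule less.hyps)
      show "card {\<delta> \<in> R. f \<delta> < f \<zeta>} < card {\<delta> \<in> R. f \<delta> < f \<gamma>}"
        using fin \<zeta> by (intro psubset_card_mono) auto
    qed (use \<zeta> in auto)
    then show ?thesis using * f by (auto intro: nat_combinations_add)
  qed
qed

lemma simple_roots_is_base:
  assumes grs: "generalized_root_system R V" and gen: "generic_functional R f"
  shows "is_base R V (simple_roots R f)"
proof (rule is_baseI)
  let ?S = "simple_roots R f"
  have fin: "finite R" and V: "V = span R" using grs by (auto simp: generalized_root_system_def)
  have lin: "linear f" using gen by (simp add: generic_functional_def)
  show sub: "?S \<subseteq> R" by (auto simp: simple_roots_def)
  show "independent ?S"
    using finite_subset[OF sub fin] lin simple_roots_obtuse[OF grs gen]
    by (intro independent_if_obtuse[of _ f]) (auto simp: simple_roots_def)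
  show comb: "\<gamma> \<in> nat_combinations ?S \<or> - \<gamma> \<in> nat_combinations ?S" if \<gamma>: "\<gamma> \<in> R" for \<gamma>
  proof -
    consider "\<gamma> = 0" | "f \<gamma> > 0" | "f (- \<gamma>) > 0"
      using gen \<gamma> linear_neg[OF lin, of \<gamma>] unfolding generic_functional_def by fastforce
    then show ?thesis
    proof cases
      case 1
      then show ?thesis unfolding nat_combinations_def
        by (intro disjI1 CollectI exI[of _ "\<lambda>_. 0"]) simp
    qed (use \<gamma> positive_root_nat_combination[OF fin gen] grs_uminus[OF grs] in auto)
  qed
  have "R \<subseteq> span ?S"
  proof
    fix \<gamma> assume "\<gamma> \<in> R"
    then have "\<gamma> \<in> span ?S \<or> - \<gamma> \<in> span ?S" using comb nat_combinations_span by blast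
    then show "\<gamma> \<in> span ?S" using span_neg[of "- \<gamma>"] by auto
  qed
  then show "span ?S = V" unfolding V using sub by (metis span_mono span_span subset_antisym)
qed

text \<open>Since the indecomposables are linearly independent, no proper subset of them spans.\<close>

lemma spanning_simple_roots:
  assumes grs: "generalized_root_system R V" and gen: "generic_functional R f"
    and sub: "T \<subseteq> simple_roots R f" and span: "V \<subseteq> span T"
  shows "T = simple_roots R f"
proof (rule ccontr)
  assume "T \<noteq> simple_roots R f"
  then obtain x where x: "x \<in> simple_roots R f" "x \<notin> T" using sub by blast
  have base: "is_base R V (simple_roots R f)" by (rule simple_roots_is_base[OF grs gen])
  then have "x \<in> span T" using x span span_base unfolding is_base_def by blast
  then have "x \<in> span (simple_roots R f - {x})"
    using sub x span_mono by (metis Diff_empty subsetD subset_Diff_insert)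
  then show False using base x unfolding is_base_def dependent_def by blast
qed

lemma functional_with_values:
  fixes S :: "'a::real_vector set" and c :: "'a \<Rightarrow> real"
  assumes "independent S"
  obtains h where "linear h" "\<forall>\<beta>\<in>S. h \<beta> = c \<beta>"
  using linear_independent_extend[OF assms, of c] by blast

lemma positive_on_base_generic:
  assumes grs: "generalized_root_system R V" and base: "is_base R V S"
    and lin: "linear f" and pos: "\<forall>\<beta>\<in>S. f \<beta> > 0"
  shows "generic_functional R f"
  unfolding generic_functional_def
proof (intro conjI ballI impI lin)
  fix \<gamma> assume "\<gamma> \<in> R" "\<gamma> \<noteq> 0"
  then show "f \<gamma> \<noteq> 0"
    using nat_combinations_pos[OF base_finite[OF grs base] lin pos, of \<gamma>]
      nat_combinations_pos[OF base_finite[OF grs base] lin pos, of "- \<gamma>"]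
    by (cases rule: base_root_cases[OF base \<open>\<gamma> \<in> R\<close>]) (auto simp: linear_neg[OF lin])
qed

lemma positive_root_in_cone:
  fixes f :: "'a::real_inner \<Rightarrow> real"
  assumes base: "is_base R V S"
    and lin: "linear f" and nonneg: "\<forall>\<beta>\<in>S. f \<beta> \<ge> 0" and \<gamma>: "\<gamma> \<in> R" "f \<gamma> > 0"
  shows "\<gamma> \<in> nat_combinations S"
  using nat_combinations_nonneg[OF lin nonneg, of "- \<gamma>"] \<gamma>
  by (cases rule: base_root_cases[OF base \<open>\<gamma> \<in> R\<close>]) (auto simp: linear_neg[OF lin])

text \<open>
  An element of a base is indecomposable because it has height 1, whereas every positive root has
  an integral height of at least 1.
\<close>

lemma base_eq_simple_roots:
  assumes grs: "generalized_root_system R V" and base: "is_base R V S"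
    and lin: "linear f" and pos: "\<forall>\<beta>\<in>S. f \<beta> > 0"
  shows "S = simple_roots R f"
proof (rule spanning_simple_roots[OF grs positive_on_base_generic[OF grs base lin pos]])
  obtain height where ht: "linear height" "\<forall>\<beta>\<in>S. height \<beta> = (1::real)"
    using functional_with_values[of S "\<lambda>_. 1"] base unfolding is_base_def by blast
  have ge1: "height \<gamma> \<ge> 1" if "\<gamma> \<in> R" "f \<gamma> > 0" for \<gamma>
  proof -
    have \<gamma>: "\<gamma> \<in> nat_combinations S"
      using positive_root_in_cone[OF base lin _ that] pos by (simp add: less_imp_le)
    have "\<gamma> \<noteq> 0" using that linear_0[OF lin] by auto
    then have "height \<gamma> > 0"
      using nat_combinations_pos[OF base_finite[OF grs base] ht(1) _ \<gamma>] ht(2) by simp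
    moreover have "height \<gamma> \<in> \<int>" using nat_combinations_Ints[OF ht(1) _ \<gamma>] ht(2) by simp
    ultimately show ?thesis by (auto elim!: Ints_cases)
  qed
  show "S \<subseteq> simple_roots R f"
  proof
    fix \<alpha> assume \<alpha>: "\<alpha> \<in> S"
    have "\<alpha> \<noteq> \<delta> + \<epsilon>" if "\<delta> \<in> R" "\<epsilon> \<in> R" "f \<delta> > 0" "f \<epsilon> > 0" for \<delta> \<epsilon>
      using ge1[of \<delta>] ge1[of \<epsilon>] that bspec[OF ht(2) \<alpha>] linear_add[OF ht(1), of \<delta> \<epsilon>] by auto
    then show "\<alpha> \<in> simple_roots R f"
      using \<alpha> pos base unfolding simple_roots_def is_base_def by blast
  qed
  show "V \<subseteq> span S" using base by (simp add: is_base_def)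
qed

section \<open>Virtual reflection of a base\<close>

text \<open>
  Elements of a base have height 1, and all roots have integral height; so no proper fraction
  of a base element is a root.
\<close>

lemma base_primitive:
  assumes grs: "generalized_root_system R V" and base: "is_base R V S" and \<alpha>: "\<alpha> \<in> S"
  shows "primitive_root R \<alpha>"
  unfolding primitive_root_def
proof (intro conjI ballI allI impI)
  show "\<alpha> \<in> R" "\<alpha> \<noteq> 0" using base \<alpha> base_nonzero by (auto simp: is_base_def)
next
  fix \<alpha>' and k :: nat
  assume *: "\<alpha>' \<in> R" "k > 0" "\<alpha> = of_nat k *\<^sub>R \<alpha>'"
  obtain h where h: "linear h" "\<forall>\<beta>\<in>S. h \<beta> = (1::real)"
    using functional_with_values[of S "\<lambda>_. 1"] base unfolding is_base_def by blast
  have hk: "1 = of_nat k * h \<alpha>'" using bspec[OF h(2) \<alpha>] linear_scale[OF h(1)] *(3) by simp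
  then have "h \<alpha>' > 0"
    by (metis of_nat_0_le_iff zero_less_mult_pos zero_less_one *(2) of_nat_0_less_iff)
  then have "\<alpha>' \<in> nat_combinations S"
    using positive_root_in_cone[OF base h(1) _ *(1)] h(2) by simp
  then have "h \<alpha>' \<in> \<int>" using nat_combinations_Ints[OF h(1), of S] h(2) by simp
  then have "h \<alpha>' \<ge> 1" using \<open>h \<alpha>' > 0\<close> by (auto elim!: Ints_cases)
  then have "real k \<le> 1" using mult_left_mono[of 1 "h \<alpha>'" "real k"] hk by simp
  then show "k = 1" using *(2) by simp
qed

lemma primitive_reflection_interval:
  fixes R :: "'a::real_inner set"
  assumes grs: "generalized_root_system R V" and \<alpha>: "\<alpha> \<in> R" "\<alpha> \<noteq> 0" and \<gamma>: "\<gamma> \<in> R"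
  obtains a b :: int where "\<And>k::int. \<gamma> + of_int k *\<^sub>R \<alpha> \<in> R \<longleftrightarrow> a \<le> k \<and> k \<le> b"
    and "primitive_reflection R \<alpha> \<gamma> = \<gamma> + of_int (a + b) *\<^sub>R \<alpha>"
proof -
  obtain \<beta> q i where str: "root_string R \<alpha> \<beta> = (\<lambda>j. \<beta> + of_nat j *\<^sub>R \<alpha>) ` {0..q}"
    and i: "i \<le> q" and \<gamma>i: "\<gamma> = \<beta> + of_nat i *\<^sub>R \<alpha>"
    using root_string_exists[OF grs \<alpha> \<gamma>] by blast
  show thesis
  proof (rule that[of "- int i" "int q - int i"])
    fix k :: int
    have shift: "\<gamma> + of_int k *\<^sub>R \<alpha> = \<beta> + of_int (int i + k) *\<^sub>R \<alpha>"
      by (simp add: \<gamma>i algebra_simps)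
    then have "\<gamma> + of_int k *\<^sub>R \<alpha> \<in> R \<longleftrightarrow> \<gamma> + of_int k *\<^sub>R \<alpha> \<in> root_string R \<alpha> \<beta>"
      unfolding shift root_string_def by blast
    also have "\<dots> \<longleftrightarrow> (\<exists>j\<in>{0..q}. of_int (int i + k) = (of_int (int j) :: real))"
      unfolding str shift image_iff using \<alpha>(2) by (simp del: of_int_add)
    also have "\<dots> \<longleftrightarrow> (\<exists>j\<in>{0..q}. int i + k = int j)" by (simp only: of_int_eq_iff)
    also have "\<dots> \<longleftrightarrow> - int i \<le> k \<and> k \<le> int q - int i"
      by (auto intro!: bexI[of _ "nat (int i + k)"])
    finally show "\<gamma> + of_int k *\<^sub>R \<alpha> \<in> R \<longleftrightarrow> - int i \<le> k \<and> k \<le> int q - int i" .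
  next
    show "primitive_reflection R \<alpha> \<gamma> = \<gamma> + of_int (- int i + (int q - int i)) *\<^sub>R \<alpha>"
      unfolding \<gamma>i primitive_reflection_string[OF \<alpha>(2) str i]
      using i by (simp add: of_nat_diff add.assoc scaleR_add_left[symmetric])
  qed
qed

lemma primitive_reflection_self:
  assumes grs: "generalized_root_system R V" and \<alpha>: "\<alpha> \<in> R" "\<alpha> \<noteq> 0"
  shows "primitive_reflection R \<alpha> \<alpha> = - \<alpha>"
proof -
  obtain a b :: int where ab: "\<And>k::int. \<alpha> + of_int k *\<^sub>R \<alpha> \<in> R \<longleftrightarrow> a \<le> k \<and> k \<le> b"
    and refl: "primitive_reflection R \<alpha> \<alpha> = \<alpha> + of_int (a + b) *\<^sub>R \<alpha>"
    using primitive_reflection_interval[OF grs \<alpha> \<alpha>(1)] by blast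
  \<comment> \<open>Negation sends \<open>(1 + k)\<alpha>\<close> to \<open>(1 + (-2 - k))\<alpha>\<close>, so it maps the interval from \<open>a\<close> to \<open>b\<close> to itself.\<close>
  have neg: "\<alpha> + of_int (- 2 - k) *\<^sub>R \<alpha> = - (\<alpha> + of_int k *\<^sub>R \<alpha>)" for k :: int
  proof -
    have "\<alpha> + of_int (- 2 - k) *\<^sub>R \<alpha> + (\<alpha> + of_int k *\<^sub>R \<alpha>) = 2 *\<^sub>R \<alpha> + (of_int (- 2 - k) + of_int k) *\<^sub>R \<alpha>"
      unfolding scaleR_add_left scaleR_2 by (simp only: ac_simps)
    also have "\<dots> = 0" by (simp add: scaleR_add_left[symmetric])
    finally show ?thesis by (rule iffD2[OF eq_neg_iff_add_eq_0])
  qed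
  have "a \<le> - 2 - k \<and> - 2 - k \<le> b" if "a \<le> k" "k \<le> b" for k
    using that ab[of k] ab[of "- 2 - k"] grs_uminus[OF grs, of "\<alpha> + of_int k *\<^sub>R \<alpha>"] neg[of k] by simp
  moreover have "a \<le> b" using ab[of 0] \<alpha> by simp
  ultimately have "a + b = - 2" by (smt (verit))
  then have "primitive_reflection R \<alpha> \<alpha> = \<alpha> + (- 2) *\<^sub>R \<alpha>" using refl by simp
  then show ?thesis by (simp add: scaleR_2)
qed

text \<open>
  The functional \<open>h\<close> is the height outside \<open>\<alpha>\<close>, the sum of the coefficients of the elements of
  \<open>S - {\<alpha>}\<close>. With \<open>g\<close> the coefficient of \<open>\<alpha>\<close>, the functional \<open>N h - g\<close> for a large constant \<open>N\<close> has the
  sign of \<open>h\<close> at every root with \<open>h\<close> nonzero, and is negative at \<open>\<alpha>\<close>. A single \<open>N\<close> suffices because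
  \<open>h\<close> is integral on the finitely many roots.
\<close>

lemma functional_across_wall:
  assumes grs: "generalized_root_system R V" and base: "is_base R V S" and \<alpha>: "\<alpha> \<in> S"
  obtains f h :: "'a::real_inner \<Rightarrow> real" where "linear f" "linear h"
    "f \<alpha> < 0" "h \<alpha> = 0" "\<And>\<beta>. \<beta> \<in> S - {\<alpha>} \<Longrightarrow> h \<beta> = 1"
    "\<And>\<gamma>. \<gamma> \<in> R \<Longrightarrow> h \<gamma> \<in> \<int>"
    "\<And>\<gamma>. \<gamma> \<in> R \<Longrightarrow> h \<gamma> > 0 \<Longrightarrow> f \<gamma> > 0"
    "\<And>\<gamma>. \<gamma> \<in> R \<Longrightarrow> h \<gamma> = 0 \<Longrightarrow> \<exists>k::int. \<gamma> = of_int k *\<^sub>R \<alpha>"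
proof -
  have ind: "independent S" and fin: "finite R" "finite S"
    using base grs base_finite by (auto simp: is_base_def generalized_root_system_def)
  obtain h where h: "linear h" "\<forall>\<beta>\<in>S. h \<beta> = (if \<beta> = \<alpha> then 0 else 1::real)"
    using functional_with_values[OF ind, of "\<lambda>\<beta>. if \<beta> = \<alpha> then 0 else 1"] by blast
  obtain g where g: "linear g" "\<forall>\<beta>\<in>S. g \<beta> = (if \<beta> = \<alpha> then 1 else 0::real)"
    using functional_with_values[OF ind, of "\<lambda>\<beta>. if \<beta> = \<alpha> then 1 else 0"] by blast
  define N where "N = 1 + (\<Sum>\<gamma>\<in>R. \<bar>g \<gamma>\<bar>)"
  define f where "f = (\<lambda>x. N * h x - g x)"
  have N: "g \<gamma> < N" if "\<gamma> \<in> R" for \<gamma>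
    using member_le_sum[OF that, of "\<lambda>\<gamma>. \<bar>g \<gamma>\<bar>"] fin(1) by (simp add: N_def)
  have hint: "h \<gamma> \<in> \<int>" if "\<gamma> \<in> R" for \<gamma>
  proof (cases rule: base_root_cases[OF base that])
    case 1
    then show ?thesis using nat_combinations_Ints[OF h(1), of S] h(2) by simp
  next
    case 2
    then have "h (- \<gamma>) \<in> \<int>" using nat_combinations_Ints[OF h(1), of S] h(2) by simp
    then show ?thesis by (simp add: linear_neg[OF h(1)])
  qed
  have mult: "\<exists>k::int. \<gamma> = of_int k *\<^sub>R \<alpha>" if \<gamma>: "\<gamma> \<in> nat_combinations S" "h \<gamma> = 0" for \<gamma>
  proof -
    obtain m :: "'a \<Rightarrow> nat" where m: "\<gamma> = (\<Sum>\<beta>\<in>S. of_nat (m \<beta>) *\<^sub>R \<beta>)"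
      using \<gamma>(1) unfolding nat_combinations_def by blast
    have "(\<Sum>\<beta>\<in>S. of_nat (m \<beta>) * h \<beta>) = 0"
      using \<gamma>(2) linear_nat_combination[OF h(1), of m S] m by simp
    then have "\<forall>\<beta>\<in>S. of_nat (m \<beta>) * h \<beta> = 0"
      using fin(2) h(2) by (subst (asm) sum_nonneg_eq_0_iff) auto
    then have "m \<beta> = 0" if "\<beta> \<in> S - {\<alpha>}" for \<beta> using that h(2) by (auto dest!: bspec[of _ _ \<beta>])
    then have "\<gamma> = of_nat (m \<alpha>) *\<^sub>R \<alpha>"
      unfolding m using fin(2) \<alpha> by (subst sum.remove[of _ \<alpha>]) (auto intro!: sum.neutral)
    then show ?thesis by (intro exI[of _ "int (m \<alpha>)"]) simp
  qed
  show thesis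
  proof (rule that[of f h])
    show "linear f"
      unfolding f_def using g(1) h(1)
      by (intro linear_compose_sub) (auto simp: linear_iff algebra_simps)
    show "f \<alpha> < 0" "h \<alpha> = 0" using \<alpha> g(2) h(2) by (auto simp: f_def)
    show "h \<beta> = 1" if "\<beta> \<in> S - {\<alpha>}" for \<beta> using that h(2) by auto
    show "f \<gamma> > 0" if "\<gamma> \<in> R" "h \<gamma> > 0" for \<gamma>
    proof -
      have "h \<gamma> \<ge> 1" using that(2) hint[OF that(1)] by (auto elim!: Ints_cases)
      moreover have "N \<ge> 0" by (simp add: N_def sum_nonneg)
      ultimately have "N * h \<gamma> \<ge> N" by (metis mult.right_neutral mult_left_mono)
      then show ?thesis using N[OF that(1)] by (simp add: f_def)
    qed
    show "\<exists>k::int. \<gamma> = of_int k *\<^sub>R \<alpha>" if \<gamma>: "\<gamma> \<in> R" "h \<gamma> = 0" for \<gamma>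
    proof (cases rule: base_root_cases[OF base \<gamma>(1)])
      case 1
      then show ?thesis using mult \<gamma>(2) by blast
    next
      case 2
      then obtain k :: int where "- \<gamma> = of_int k *\<^sub>R \<alpha>"
        using mult[of "- \<gamma>"] \<gamma>(2) linear_neg[OF h(1)] by auto
      then have "\<gamma> = of_int (- k) *\<^sub>R \<alpha>" by (metis minus_minus of_int_minus scaleR_minus_left)
      then show ?thesis by blast
    qed
  qed (use h hint in auto)
qed

text \<open>
  A decomposition of \<open>-\<alpha>\<close> or of the reflected \<open>\<beta>\<close> into roots positive for the new functional has a
  summand of height 0 outside \<open>\<alpha>\<close>, that is, a negative integral multiple of \<open>\<alpha>\<close>. For \<open>-\<alpha>\<close> this
  applies to both summands, whose coefficients would then add up to at most -2; for \<open>\<beta>\<close> the other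
  summand would lie beyond the end of the string.
  The third conclusion records that only the multiples of \<open>\<alpha>\<close> change sign.
\<close>

lemma reflected_base_eq_simple_roots:
  assumes grs: "generalized_root_system R V" and base: "is_base R V S" and \<alpha>: "\<alpha> \<in> S"
  obtains f where "generic_functional R f" "virtual_reflection R \<alpha> ` S = simple_roots R f"
    "\<And>\<gamma>. \<gamma> \<in> R \<Longrightarrow> f \<gamma> > 0 \<Longrightarrow> \<gamma> \<in> nat_combinations S \<or> (\<exists>k::int. k < 0 \<and> \<gamma> = of_int k *\<^sub>R \<alpha>)"
proof -
  obtain f h :: "'a \<Rightarrow> real" where lin: "linear f" "linear h"
    and f\<alpha>: "f \<alpha> < 0" and h\<alpha>: "h \<alpha> = 0" and h1: "\<And>\<beta>. \<beta> \<in> S - {\<alpha>} \<Longrightarrow> h \<beta> = 1"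
    and hint: "\<And>\<gamma>. \<gamma> \<in> R \<Longrightarrow> h \<gamma> \<in> \<int>"
    and hpos: "\<And>\<gamma>. \<gamma> \<in> R \<Longrightarrow> h \<gamma> > 0 \<Longrightarrow> f \<gamma> > 0"
    and h0: "\<And>\<gamma>. \<gamma> \<in> R \<Longrightarrow> h \<gamma> = 0 \<Longrightarrow> \<exists>k::int. \<gamma> = of_int k *\<^sub>R \<alpha>"
    using functional_across_wall[OF grs base \<alpha>] by metis
  have \<alpha>R: "\<alpha> \<in> R" "\<alpha> \<noteq> 0" and SR: "S \<subseteq> R" and SV: "span S = V"
    using base \<alpha> base_nonzero by (auto simp: is_base_def)
  let ?\<sigma> = "virtual_reflection R \<alpha>"
  have \<sigma>: "?\<sigma> = primitive_reflection R \<alpha>"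
    using base_primitive[OF grs base \<alpha>] by (simp add: virtual_reflection_def)
  have h_nonneg: "h \<gamma> \<ge> 0" if "\<gamma> \<in> R" "f \<gamma> > 0" for \<gamma>
    using hpos[OF grs_uminus[OF grs that(1)]] that(2)
    by (auto simp: linear_neg[OF lin(1)] linear_neg[OF lin(2)] not_less[symmetric])
  have neg_multiple: "\<exists>k::int. k < 0 \<and> \<gamma> = of_int k *\<^sub>R \<alpha>" if \<gamma>: "\<gamma> \<in> R" "f \<gamma> > 0" "h \<gamma> = 0" for \<gamma>
  proof -
    obtain k :: int where k: "\<gamma> = of_int k *\<^sub>R \<alpha>" using h0 \<gamma> by blast
    then have "of_int k * f \<alpha> > 0" using \<gamma>(2) by (simp add: linear_scale[OF lin(1)])
    then have "k < 0" using f\<alpha> by (simp add: zero_less_mult_iff)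
    then show ?thesis using k by blast
  qed
  have gen: "generic_functional R f"
    unfolding generic_functional_def
  proof (intro conjI ballI impI lin(1))
    fix \<gamma> assume \<gamma>: "\<gamma> \<in> R" "\<gamma> \<noteq> 0"
    consider "h \<gamma> > 0" | "h (- \<gamma>) > 0" | "h \<gamma> = 0" using linear_neg[OF lin(2), of \<gamma>] by linarith
    then show "f \<gamma> \<noteq> 0"
    proof cases
      case 1
      then show ?thesis using hpos \<gamma> by force
    next
      case 2
      then show ?thesis using hpos[OF grs_uminus[OF grs \<gamma>(1)]] linear_neg[OF lin(1), of \<gamma>] by auto
    next
      case 3
      then obtain k :: int where "\<gamma> = of_int k *\<^sub>R \<alpha>" using h0 \<gamma> by blast
      then show ?thesis using \<gamma> f\<alpha> by (auto simp: linear_scale[OF lin(1)])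
    qed
  qed
  have \<sigma>\<alpha>: "?\<sigma> \<alpha> = - \<alpha>" unfolding \<sigma> by (rule primitive_reflection_self[OF grs \<alpha>R])
  have \<sigma>\<beta>: "\<exists>q::int. ?\<sigma> \<beta> = \<beta> + of_int q *\<^sub>R \<alpha> \<and> ?\<sigma> \<beta> \<in> R \<and> (\<forall>k>q. \<beta> + of_int k *\<^sub>R \<alpha> \<notin> R)"
    if \<beta>: "\<beta> \<in> S - {\<alpha>}" for \<beta>
  proof -
    have \<beta>R: "\<beta> \<in> R" using \<beta> SR by blast
    obtain a b :: int where ab: "\<And>k::int. \<beta> + of_int k *\<^sub>R \<alpha> \<in> R \<longleftrightarrow> a \<le> k \<and> k \<le> b"
      and refl: "primitive_reflection R \<alpha> \<beta> = \<beta> + of_int (a + b) *\<^sub>R \<alpha>"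
      using primitive_reflection_interval[OF grs \<alpha>R \<beta>R] by blast
    \<comment> \<open>\<open>\<beta> - \<alpha>\<close> has coefficients of both signs, so the string through \<open>\<beta>\<close> starts at \<open>\<beta>\<close>.\<close>
    have "\<beta> - \<alpha> \<notin> R"
    proof
      assume d: "\<beta> - \<alpha> \<in> R"
      obtain g where g: "linear g" "\<forall>\<gamma>\<in>S. g \<gamma> = (if \<gamma> = \<alpha> then 1 else 0::real)"
        using functional_with_values[of S "\<lambda>\<gamma>. if \<gamma> = \<alpha> then 1 else 0"] base
        unfolding is_base_def by blast
      have vals: "g (\<beta> - \<alpha>) = - 1" "h (\<beta> - \<alpha>) = 1"
        using g(2) \<alpha> \<beta> h1 h\<alpha> by (auto simp: linear_diff[OF g(1)] linear_diff[OF lin(2)])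
      have "\<beta> - \<alpha> \<in> nat_combinations S"
        using positive_root_in_cone[OF base lin(2) _ d] vals h1 h\<alpha>
        by (metis DiffI order_refl singletonD zero_le_one zero_less_one)
      then have "g (\<beta> - \<alpha>) \<ge> 0" using nat_combinations_nonneg[OF g(1), of S] g(2) by simp
      then show False using vals by simp
    qed
    then have "a = 0" using ab[of "- 1"] ab[of 0] \<beta>R by simp
    then show ?thesis using refl ab ab[of 0] \<beta>R unfolding \<sigma> by (intro exI[of _ b]) auto
  qed
  have \<sigma>\<beta>_simple: "?\<sigma> \<beta> \<in> simple_roots R f" if \<beta>: "\<beta> \<in> S - {\<alpha>}" for \<beta>
  proof -
    obtain q :: int where q: "?\<sigma> \<beta> = \<beta> + of_int q *\<^sub>R \<alpha>" "?\<sigma> \<beta> \<in> R"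
      and top: "\<And>k. k > q \<Longrightarrow> \<beta> + of_int k *\<^sub>R \<alpha> \<notin> R" using \<sigma>\<beta>[OF \<beta>] by blast
    have h\<sigma>: "h (?\<sigma> \<beta>) = 1"
      using h1[OF \<beta>] h\<alpha> unfolding q(1) by (simp add: linear_add[OF lin(2)] linear_scale[OF lin(2)])
    have no: False
      if \<delta>: "\<delta> \<in> R" "f \<delta> > 0" and \<epsilon>: "\<epsilon> \<in> R" "f \<epsilon> > 0" and eq: "?\<sigma> \<beta> = \<delta> + \<epsilon>" and "h \<epsilon> = 0" for \<delta> \<epsilon>
    proof -
      obtain k :: int where k: "k < 0" "\<epsilon> = of_int k *\<^sub>R \<alpha>" using neg_multiple[OF \<epsilon> \<open>h \<epsilon> = 0\<close>] by blast
      have "\<delta> = \<beta> + of_int (q - k) *\<^sub>R \<alpha>" using eq k(2) q(1) by (simp add: algebra_simps)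
      then show False using top[of "q - k"] k(1) \<delta>(1) by simp
    qed
    have "False" if \<delta>: "\<delta> \<in> R" "f \<delta> > 0" and \<epsilon>: "\<epsilon> \<in> R" "f \<epsilon> > 0" and eq: "?\<sigma> \<beta> = \<delta> + \<epsilon>" for \<delta> \<epsilon>
    proof -
      have sum: "h \<delta> + h \<epsilon> = 1" using h\<sigma> eq by (simp add: linear_add[OF lin(2)])
      obtain m n :: int where mn: "h \<delta> = of_int m" "h \<epsilon> = of_int n"
        using hint \<delta>(1) \<epsilon>(1) by (meson Ints_cases)
      have "m + n = 1" "m \<ge> 0" "n \<ge> 0"
        using sum h_nonneg[OF \<delta>] h_nonneg[OF \<epsilon>] unfolding mn by linarith+
      then consider "m = 0" | "n = 0" by linarith
      then show False
        using no[OF \<delta> \<epsilon> eq] no[OF \<epsilon> \<delta>] eq mn by cases (auto simp: add.commute)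
    qed
    then show ?thesis using q(2) hpos[OF q(2)] h\<sigma> unfolding simple_roots_def by auto
  qed
  have \<sigma>\<alpha>_simple: "- \<alpha> \<in> simple_roots R f"
  proof -
    have "False" if \<delta>: "\<delta> \<in> R" "f \<delta> > 0" and \<epsilon>: "\<epsilon> \<in> R" "f \<epsilon> > 0" and eq: "- \<alpha> = \<delta> + \<epsilon>" for \<delta> \<epsilon>
    proof -
      have "h \<delta> + h \<epsilon> = h (- \<alpha>)" using eq by (simp add: linear_add[OF lin(2)])
      then have "h \<delta> + h \<epsilon> = 0" using h\<alpha> by (simp add: linear_neg[OF lin(2)])
      then have "h \<delta> = 0" "h \<epsilon> = 0" using h_nonneg[OF \<delta>] h_nonneg[OF \<epsilon>] by linarith+
      then obtain k l :: int where kl: "k < 0" "\<delta> = of_int k *\<^sub>R \<alpha>" "l < 0" "\<epsilon> = of_int l *\<^sub>R \<alpha>"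
        using neg_multiple \<delta> \<epsilon> by meson
      then have "of_int (k + l + 1) *\<^sub>R \<alpha> = 0"
        using eq by (simp add: scaleR_add_left eq_neg_iff_add_eq_0[symmetric])
      then have "k + l + 1 = 0" using \<alpha>R(2) by (metis of_int_eq_0_iff scaleR_eq_0_iff)
      then show False using kl by simp
    qed
    then show ?thesis
      using grs_uminus[OF grs \<alpha>R(1)] f\<alpha> unfolding simple_roots_def by (auto simp: linear_neg[OF lin(1)])
  qed
  show thesis
  proof (rule that[OF gen])
    show "?\<sigma> ` S = simple_roots R f"
    proof (rule spanning_simple_roots[OF grs gen])
      show "?\<sigma> ` S \<subseteq> simple_roots R f" using \<sigma>\<alpha>_simple \<sigma>\<beta>_simple \<sigma>\<alpha> by force
      have *: "\<alpha> \<in> span (?\<sigma> ` S)"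
        using span_neg[OF span_base[OF imageI[OF \<alpha>, of ?\<sigma>]]] \<sigma>\<alpha> by simp
      have "\<beta> \<in> span (?\<sigma> ` S)" if \<beta>: "\<beta> \<in> S - {\<alpha>}" for \<beta>
      proof -
        obtain q :: int where "?\<sigma> \<beta> = \<beta> + of_int q *\<^sub>R \<alpha>" using \<sigma>\<beta>[OF \<beta>] by blast
        then have "\<beta> = ?\<sigma> \<beta> - of_int q *\<^sub>R \<alpha>" by simp
        moreover have "?\<sigma> \<beta> \<in> span (?\<sigma> ` S)" using \<beta> by (intro span_base) auto
        ultimately show ?thesis using * by (metis span_diff span_scale)
      qed
      then show "V \<subseteq> span (?\<sigma> ` S)" using * SV by (metis Diff_iff singletonD span_minimal subsetI subspace_span)
    qed
    show "\<gamma> \<in> nat_combinations S \<or> (\<exists>k::int. k < 0 \<and> \<gamma> = of_int k *\<^sub>R \<alpha>)"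
      if \<gamma>: "\<gamma> \<in> R" "f \<gamma> > 0" for \<gamma>
    proof (cases "h \<gamma> = 0")
      case True
      then show ?thesis using neg_multiple[OF \<gamma>] by blast
    next
      case False
      then have "h \<gamma> > 0" using h_nonneg[OF \<gamma>] by simp
      then show ?thesis using positive_root_in_cone[OF base lin(2) _ \<gamma>(1)] h1 h\<alpha>
        by (metis DiffI order_refl singletonD zero_le_one)
    qed
  qed
qed

section \<open>Connecting two bases\<close>

definition reflection_step :: "'a::real_inner set \<Rightarrow> 'a set \<Rightarrow> 'a set \<Rightarrow> 'a set \<Rightarrow> bool" where
  "reflection_step R V S T \<longleftrightarrow>
     is_base R V S \<and> is_base R V T \<and> (\<exists>\<alpha>\<in>S. T = virtual_reflection R \<alpha> ` S)"

lemma reflection_steps_connect: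
  fixes f'' :: "'a::real_inner \<Rightarrow> real"
  assumes grs: "generalized_root_system R V" and target: "is_base R V S''"
    and lin'': "linear f''" and pos'': "\<forall>\<beta>\<in>S''. f'' \<beta> > 0"
    and "is_base R V S"
  shows "(reflection_step R V)\<^sup>*\<^sup>* S S''"
  using assms(5)
proof (induction "card {\<gamma> \<in> R \<inter> nat_combinations S. f'' \<gamma> < 0}" arbitrary: S rule: less_induct)
  case less
  note base = less.prems
  have finR: "finite R" using grs by (simp add: generalized_root_system_def)
  have SR: "S \<subseteq> R" using base by (simp add: is_base_def)
  show ?case
  proof (cases "\<forall>\<alpha>\<in>S. f'' \<alpha> > 0")
    case True
    then have "S = S''"
      using base_eq_simple_roots[OF grs base lin'' True] base_eq_simple_roots[OF grs target lin'' pos'']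
      by simp
    then show ?thesis by simp
  next
    case False
    then obtain \<alpha> where \<alpha>: "\<alpha> \<in> S" "\<not> f'' \<alpha> > 0" by blast
    then have neg: "f'' \<alpha> < 0"
      using positive_on_base_generic[OF grs target lin'' pos''] SR base_nonzero[OF base]
      unfolding generic_functional_def by (metis linorder_neqE subsetD)
    let ?T = "virtual_reflection R \<alpha> ` S"
    obtain f where gen: "generic_functional R f" and T: "?T = simple_roots R f"
      and signs: "\<And>\<gamma>. \<gamma> \<in> R \<Longrightarrow> f \<gamma> > 0 \<Longrightarrow>
        \<gamma> \<in> nat_combinations S \<or> (\<exists>k::int. k < 0 \<and> \<gamma> = of_int k *\<^sub>R \<alpha>)"
      using reflected_base_eq_simple_roots[OF grs base \<alpha>(1)] by metis
    have baseT: "is_base R V ?T" unfolding T by (rule simple_roots_is_base[OF grs gen])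
    have fT: "f \<gamma> > 0" if "\<gamma> \<in> nat_combinations ?T" "\<gamma> \<noteq> 0" for \<gamma>
      using nat_combinations_pos[OF base_finite[OF grs baseT] _ _ that] gen
      unfolding T generic_functional_def simple_roots_def by blast
    have "{\<gamma> \<in> R \<inter> nat_combinations ?T. f'' \<gamma> < 0} \<subseteq> {\<gamma> \<in> R \<inter> nat_combinations S. f'' \<gamma> < 0}"
    proof safe
      fix \<gamma> assume \<gamma>: "\<gamma> \<in> R" "\<gamma> \<in> nat_combinations ?T" "f'' \<gamma> < 0"
      have "\<gamma> \<noteq> 0" using \<gamma>(3) linear_0[OF lin''] by auto
      moreover have "\<not> (\<exists>k::int. k < 0 \<and> \<gamma> = of_int k *\<^sub>R \<alpha>)"
        using \<gamma>(3) neg by (auto simp: linear_scale[OF lin''] mult_less_0_iff)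
      ultimately show "\<gamma> \<in> nat_combinations S" using signs[OF \<gamma>(1) fT[OF \<gamma>(2)]] by blast
    qed
    moreover have "\<alpha> \<in> nat_combinations S"
      by (rule nat_combinations_base[OF base_finite[OF grs base] \<alpha>(1)])
    moreover have "\<alpha> \<notin> nat_combinations ?T"
    proof
      assume "\<alpha> \<in> nat_combinations ?T"
      then have "f \<alpha> > 0" using fT base_nonzero[OF base \<alpha>(1)] by blast
      \<comment> \<open>But \<open>-\<alpha>\<close> lies in the reflected base.\<close>
      moreover have "virtual_reflection R \<alpha> \<alpha> = - \<alpha>"
        using primitive_reflection_self[OF grs] base_primitive[OF grs base \<alpha>(1)]
        by (simp add: virtual_reflection_def primitive_root_def)
      then have "- \<alpha> \<in> simple_roots R f" using T \<alpha>(1) by (metis imageI)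
      then have "f (- \<alpha>) > 0" by (simp add: simple_roots_def)
      ultimately show False
        using gen unfolding generic_functional_def by (simp add: linear_neg)
    qed
    ultimately have "card {\<gamma> \<in> R \<inter> nat_combinations ?T. f'' \<gamma> < 0}
        < card {\<gamma> \<in> R \<inter> nat_combinations S. f'' \<gamma> < 0}"
      using finR neg SR \<alpha>(1) by (intro psubset_card_mono) auto
    then have "(reflection_step R V)\<^sup>*\<^sup>* ?T S''" using less.hyps baseT by blast
    moreover have "reflection_step R V S ?T"
      using base baseT \<alpha>(1) unfolding reflection_step_def by blast
    ultimately show ?thesis by (rule converse_rtranclp_into_rtranclp[rotated])
  qed
qed

theorem proposition2p7:
  fixes R V S' S'' :: "'a::real_inner set"
  assumes "generalized_root_system R V"
    and "is_base R V S'"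
    and "is_base R V S''"
  shows "\<exists>(k::nat) (S :: nat \<Rightarrow> 'a set) (\<alpha> :: nat \<Rightarrow> 'a).
           S 0 = S' \<and> S k = S'' \<and>
           (\<forall>i\<le>k. is_base R V (S i)) \<and>
           (\<forall>i<k. \<alpha> i \<in> S i \<and> S (Suc i) = virtual_reflection R (\<alpha> i) ` S i)"
proof -
  obtain f'' where "linear f''" "\<forall>\<beta>\<in>S''. f'' \<beta> = (1::real)"
    using functional_with_values[of S'' "\<lambda>_. 1"] assms(3) unfolding is_base_def by blast
  then have "(reflection_step R V)\<^sup>*\<^sup>* S' S''"
    using reflection_steps_connect[OF assms(1,3) _ _ assms(2), of f''] by simp
  then obtain k where "(reflection_step R V ^^ k) S' S''" using rtranclp_imp_relpowp by metis
  then obtain S where S: "S 0 = S'" "S k = S''" "\<And>i. i < k \<Longrightarrow> reflection_step R V (S i) (S (Suc i))"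
    unfolding relpowp_fun_conv by blast
  have "is_base R V (S i)" if "i \<le> k" for i
    using that S assms(3) unfolding reflection_step_def by (cases "i = k") auto
  moreover obtain \<alpha> where "\<And>i. i < k \<Longrightarrow> \<alpha> i \<in> S i \<and> S (Suc i) = virtual_reflection R (\<alpha> i) ` S i"
    using S(3) unfolding reflection_step_def by metis
  ultimately show ?thesis using S(1,2) by (intro exI[of _ k] exI[of _ S] exI[of _ \<alpha>]) simp
qed

end
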